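(* Let $(G,D,\star)$ be a complete probabilistic metric space, where $\star$ is a continuous triangle function with modulus of uniform continuity $\omega_\star$. Let $f:G\to G$ be an $\omega_\star$-contraction with constant of contraction $q\in(0,1)$, i.e. for all $x,y\in G$ $$\omega_\star\big[d_{\mathcal L}(D(f(x),f(y)),\mathcal H_0)\big]\le q\,\omega_\star\big[d_{\mathcal L}(D(x,y),\mathcal H_0)\big].$$ Then $f$ has a unique fixed point $x^*\in G$.
   Context: $\Delta^+$ is the set of all (cumulative) distribution functions $F:[-\infty,+\infty]\to[0,1]$, nondecreasing and left-continuous, with $F(-\infty)=0$, $F(+\infty)=1$ and $F(0)=0$. $\mathcal H_0(t)=0$ if $t\le 0$ and $\mathcal H_0(t)=1$ if $t>0$. Order: $F\le L$ iff $F(t)\le L(t)$ for all $t\in\mathbb R$. Modified Lévy distance: for $F,L\in\Delta^+$ and $h>0$ let $A^h_{F,L}=\{t\ge 0: L(t)\le F(t+h)+h\}$, and $d_{\mathcal L}(F,L)=\inf\{h>0:[0,h^{-1})\subset A^h_{F,L}\cap A^h_{L,F}\}$. A sequence $(F_n)$ in $\Delta^+$ converges weakly to $F\in\Delta^+$ if $F_n(t)\to F(t)$ at every continuity point $t$ of $F$; this is equivalent to $d_{\mathcal L}(F_n,F)\to0$. A triangle function is a binary operation $\star$ on $\Delta^+$ that is commutative, associative, nondecreasing in each place, with neutral element $\mathcal H_0$. It is continuous if $F_n\to F$ and $L_n\to L$ weakly imply $F_n\star L_n\to F\star L$ weakly. A modulus of uniform continuity of $\star$ is a function $\omega_\star:[0,+\infty]\to[0,+\infty]$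 with $\lim_{t\to0}\omega_\star(t)=\omega_\star(0)=0$ and $d_{\mathcal L}(F\star L,F'\star L')\le\omega_\star(d_{\mathcal L}(F,F')+d_{\mathcal L}(L,L'))$ for all $F,L,F',L'\in\Delta^+$. A probabilistic metric space $(G,D,\star)$ is a set $G$ with a triangle function $\star$ and a map $D:G\times G\to\Delta^+$ such that $D(x,y)=\mathcal H_0$ iff $x=y$; $D(x,y)=D(y,x)$; and $D(x,y)\star D(y,z)\le D(x,z)$ for all $x,y,z\in G$. A sequence $(z_n)$ in $G$ is Cauchy if $\lim_{n,p\to\infty}D(z_n,z_p)(t)=\mathcal H_0(t)$ for all $t\in\mathbb R$ (equivalently $d_{\mathcal L}(D(z_n,z_p),\mathcal H_0)\to0$). $(G,D,\star)$ is complete if for every Cauchy sequence $(z_n)$ there is $z_\infty\in G$ with $\lim_n D(z_n,z_\infty)(t)=\mathcal H_0(t)$ for all $t\in\mathbb R$.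
   Formalization: G is assumed nonempty and ω⋆ finite at every d_L(D(x,y),H_0), x,y in G; if ω⋆ may be +∞ there, the claim fails: with ω⋆=+∞ on [1/2,+∞], the swap of two points at Lévy distance 1 is a contraction (∞ ≤ q·∞) without a fixed point. *)

theory Defs
  imports "HOL-Library.Extended_Nonnegative_Real" "HOL-Library.FuncSet"
begin

text \<open>
  Left continuity is required at the points of \<open>\<real>\<close> only (the usual convention): a jump at
  \<open>+\<infinity>\<close> is allowed, so defective distributions belong to the space.
\<close>
definition Delta_plus :: "(ereal \<Rightarrow> real) set" where
  "Delta_plus = {F. range F \<subseteq> {0..1} \<and> mono F \<and>
     (\<forall>t::real. continuous (at_left t) (\<lambda>s. F (ereal s))) \<and>
     F (-\<infinity>) = 0 \<and> F \<infinity> = 1 \<and> F 0 = 0}"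

definition H0 :: "ereal \<Rightarrow> real" where
  "H0 t = (if t \<le> 0 then 0 else 1)"

definition df_le :: "(ereal \<Rightarrow> real) \<Rightarrow> (ereal \<Rightarrow> real) \<Rightarrow> bool" where
  "df_le F L \<longleftrightarrow> (\<forall>t::real. F (ereal t) \<le> L (ereal t))"

definition levy_set :: "real \<Rightarrow> (ereal \<Rightarrow> real) \<Rightarrow> (ereal \<Rightarrow> real) \<Rightarrow> real set" where
  "levy_set h F L = {t. 0 \<le> t \<and> L (ereal t) \<le> F (ereal (t + h)) + h}"

text \<open>
  On \<open>Delta_plus\<close> the set below contains \<open>1\<close> and is bounded below by \<open>0\<close>, so the real-valued
  infimum is the true one and lies in \<open>{0..1}\<close>.
\<close>
definition levy_dist :: "(ereal \<Rightarrow> real) \<Rightarrow> (ereal \<Rightarrow> real) \<Rightarrow> real" where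
  "levy_dist F L = Inf {h. 0 < h \<and> {0..<inverse h} \<subseteq> levy_set h F L \<inter> levy_set h L F}"

definition weakly_converges :: "(nat \<Rightarrow> ereal \<Rightarrow> real) \<Rightarrow> (ereal \<Rightarrow> real) \<Rightarrow> bool" where
  "weakly_converges Fn F \<longleftrightarrow>
     (\<forall>t::real. isCont (\<lambda>s. F (ereal s)) t \<longrightarrow> (\<lambda>n. Fn n (ereal t)) \<longlonglongrightarrow> F (ereal t))"

type_synonym df_op = "(ereal \<Rightarrow> real) \<Rightarrow> (ereal \<Rightarrow> real) \<Rightarrow> (ereal \<Rightarrow> real)"

definition triangle_function :: "df_op \<Rightarrow> bool" where
  "triangle_function star \<longleftrightarrow>
     (\<forall>F\<in>Delta_plus. \<forall>L\<in>Delta_plus. star F L \<in> Delta_plus) \<and>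
     (\<forall>F\<in>Delta_plus. \<forall>L\<in>Delta_plus. star F L = star L F) \<and>
     (\<forall>F\<in>Delta_plus. \<forall>L\<in>Delta_plus. \<forall>K\<in>Delta_plus. star (star F L) K = star F (star L K)) \<and>
     (\<forall>F\<in>Delta_plus. \<forall>F'\<in>Delta_plus. \<forall>L\<in>Delta_plus.
        df_le F F' \<longrightarrow> df_le (star F L) (star F' L) \<and> df_le (star L F) (star L F')) \<and>
     (\<forall>F\<in>Delta_plus. star F H0 = F \<and> star H0 F = F)"

definition continuous_triangle_function :: "df_op \<Rightarrow> bool" where
  "continuous_triangle_function star \<longleftrightarrow> triangle_function star \<and>
     (\<forall>Fn Ln F L. (\<forall>n. Fn n \<in> Delta_plus) \<and> (\<forall>n. Ln n \<in> Delta_plus) \<and>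
        F \<in> Delta_plus \<and> L \<in> Delta_plus \<and> weakly_converges Fn F \<and> weakly_converges Ln L
        \<longrightarrow> weakly_converges (\<lambda>n. star (Fn n) (Ln n)) (star F L))"

definition modulus_unif_cont :: "df_op \<Rightarrow> (ennreal \<Rightarrow> ennreal) \<Rightarrow> bool" where
  "modulus_unif_cont star \<omega> \<longleftrightarrow> (\<omega> \<longlongrightarrow> 0) (at 0) \<and> \<omega> 0 = 0 \<and>
     (\<forall>F\<in>Delta_plus. \<forall>L\<in>Delta_plus. \<forall>F'\<in>Delta_plus. \<forall>L'\<in>Delta_plus.
        ennreal (levy_dist (star F L) (star F' L'))
          \<le> \<omega> (ennreal (levy_dist F F' + levy_dist L L')))"

definition prob_metric_space :: "'a set \<Rightarrow> ('a \<Rightarrow> 'a \<Rightarrow> ereal \<Rightarrow> real) \<Rightarrow> df_op \<Rightarrow> bool" where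
  "prob_metric_space G D star \<longleftrightarrow> triangle_function star \<and>
     (\<forall>x\<in>G. \<forall>y\<in>G. D x y \<in> Delta_plus) \<and>
     (\<forall>x\<in>G. \<forall>y\<in>G. D x y = H0 \<longleftrightarrow> x = y) \<and>
     (\<forall>x\<in>G. \<forall>y\<in>G. D x y = D y x) \<and>
     (\<forall>x\<in>G. \<forall>y\<in>G. \<forall>z\<in>G. df_le (star (D x y) (D y z)) (D x z))"

definition pm_Cauchy :: "('a \<Rightarrow> 'a \<Rightarrow> ereal \<Rightarrow> real) \<Rightarrow> (nat \<Rightarrow> 'a) \<Rightarrow> bool" where
  "pm_Cauchy D z \<longleftrightarrow> (\<forall>t::real.
     ((\<lambda>(n, p). D (z n) (z p) (ereal t)) \<longlongrightarrow> H0 (ereal t)) (sequentially \<times>\<^sub>F sequentially))"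

definition pm_complete :: "'a set \<Rightarrow> ('a \<Rightarrow> 'a \<Rightarrow> ereal \<Rightarrow> real) \<Rightarrow> bool" where
  "pm_complete G D \<longleftrightarrow> (\<forall>z. (\<forall>n. z n \<in> G) \<and> pm_Cauchy D z \<longrightarrow>
     (\<exists>w\<in>G. \<forall>t::real. (\<lambda>n. D (z n) w (ereal t)) \<longlonglongrightarrow> H0 (ereal t)))"

text \<open>
  In \<open>ennreal\<close>, \<open>ennreal q * \<infinity> = \<infinity>\<close> for \<open>q > 0\<close>, so the inequality carries no information at
  pairs where \<open>\<omega>\<close> is infinite: with \<open>\<omega> = \<infinity>\<close> away from \<open>0\<close>, the swap of two points at Levy
  distance \<open>1\<close> satisfies it.  Finiteness at the distances occurring here has to be assumed
  separately.
\<close>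
definition modulus_contraction ::
  "'a set \<Rightarrow> ('a \<Rightarrow> 'a \<Rightarrow> ereal \<Rightarrow> real) \<Rightarrow> (ennreal \<Rightarrow> ennreal) \<Rightarrow> real \<Rightarrow> ('a \<Rightarrow> 'a) \<Rightarrow> bool" where
  "modulus_contraction G D \<omega> q f \<longleftrightarrow> (\<forall>x\<in>G. \<forall>y\<in>G.
     \<omega> (ennreal (levy_dist (D (f x) (f y)) H0))
       \<le> ennreal q * \<omega> (ennreal (levy_dist (D x y) H0)))"

end

theory Submission
  imports Defs
begin

text \<open>
  Write \<open>\<delta> x y\<close> for the Levy distance from \<open>D x y\<close> to \<open>H0\<close>. Monotonicity of the triangle function
  turns its modulus into a weak triangle inequality \<open>\<delta> x z \<le> \<omega> (\<delta> x y + \<delta> y z)\<close>, and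
  \<open>\<delta> x y \<le> \<omega> (\<delta> x y)\<close> because \<open>H0\<close> is neutral. Since \<open>\<omega>\<close> need be neither monotone nor bounded,
  no uniform bound on \<open>\<omega> (\<delta> x (f\<^sup>n x))\<close> is at hand to make the orbit of \<open>x\<close> Cauchy. Instead, for
  suitable \<open>N\<close> and all large \<open>n\<close>, the map \<open>f\<^sup>N\<close> sends the ball
  \<open>{y. \<omega> (\<delta> (f\<^sup>n x) y) < r}\<close> into itself, and this ball contains the first \<open>N\<close> iterates of \<open>f\<^sup>n x\<close>,
  hence the whole orbit from \<open>f\<^sup>n x\<close> on. The limit of the orbit is then fixed by the weak triangle
  inequality.
\<close>

section \<open>Distribution functions and the Levy distance to \<open>H0\<close>\<close>

lemma Delta_plus_bounds: "F \<in> Delta_plus \<Longrightarrow> 0 \<le> F t \<and> F t \<le> 1"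
  by (force simp: Delta_plus_def)

lemma Delta_plus_mono: "F \<in> Delta_plus \<Longrightarrow> s \<le> t \<Longrightarrow> F s \<le> F t"
  by (auto simp: Delta_plus_def mono_def)

lemma Delta_plus_nonpos: "F \<in> Delta_plus \<Longrightarrow> t \<le> 0 \<Longrightarrow> F t = 0"
  using Delta_plus_mono[of F t 0] Delta_plus_bounds[of F t] by (auto simp: Delta_plus_def)

lemma H0_in_Delta_plus: "H0 \<in> Delta_plus"
proof -
  have "continuous (at_left t) (\<lambda>s. H0 (ereal s))" for t :: real
  proof (cases "t \<le> 0")
    case True
    have "\<forall>\<^sub>F s in at_left t. H0 (ereal t) = H0 (ereal s)"
      using True by (auto simp: H0_def eventually_at_filter)
    then show ?thesis
      unfolding continuous_within by (rule tendsto_eventually[OF eventually_mono]) auto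
  next
    case False
    then have "\<forall>\<^sub>F s in at_left t. s \<in> {0<..<t}"
      by (intro eventually_at_left_real) simp
    then have "\<forall>\<^sub>F s in at_left t. H0 (ereal s) = H0 (ereal t)"
      by eventually_elim (auto simp: H0_def)
    then show ?thesis
      unfolding continuous_within by (rule tendsto_eventually)
  qed
  then show ?thesis
    by (auto simp: Delta_plus_def mono_def H0_def)
qed

text \<open>Against \<open>H0\<close> the two Levy conditions collapse to one. The bound on
  \<open>F\<close> from above is trivial, since \<open>H0\<close> equals 1 at
  \<open>t + h > 0\<close>; the bound from below matters only for \<open>t > 0\<close>, where
  monotonicity reduces it to the value of \<open>F\<close> at \<open>h\<close>.\<close>

lemma levy_dist_H0_le:
  assumes F: "F \<in> Delta_plus" and "0 < h" and Fh: "1 - h \<le> F (ereal h)"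
  shows "levy_dist F H0 \<le> h"
proof -
  have "H0 (ereal t) \<le> F (ereal (t + h)) + h" if "0 \<le> t" for t
    using Delta_plus_mono[OF F, of h "t + h"] Delta_plus_bounds[OF F, of "t + h"] that Fh \<open>0 < h\<close>
    by (auto simp: H0_def)
  moreover have "F (ereal t) \<le> H0 (ereal (t + h)) + h" if "0 \<le> t" for t
    using Delta_plus_bounds[OF F, of t] that \<open>0 < h\<close> by (auto simp: H0_def)
  ultimately show ?thesis
    unfolding levy_dist_def using \<open>0 < h\<close>
    by (intro cInf_lower) (auto simp: levy_set_def intro!: bdd_belowI[of _ 0])
qed

lemma one_in_levy_dist_set:
  assumes F: "F \<in> Delta_plus"
  shows "(1::real) \<in> {h. 0 < h \<and> {0..<inverse h} \<subseteq> levy_set h F H0 \<inter> levy_set h H0 F}"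
  using Delta_plus_bounds[OF F] by (auto simp: levy_set_def H0_def add_increasing)

lemma levy_dist_H0_nonneg: "F \<in> Delta_plus \<Longrightarrow> 0 \<le> levy_dist F H0"
  unfolding levy_dist_def using one_in_levy_dist_set[of F] by (intro cInf_greatest) force+

text \<open>Near-converse of \<open>levy_dist_H0_le\<close>. Together they replace the infimum by
  the criterion \<open>1 - h \<le> F (ereal h)\<close>, through which all later facts about the
  distance to \<open>H0\<close> pass.\<close>

lemma levy_dist_H0_lessD:
  assumes F: "F \<in> Delta_plus" and less: "levy_dist F H0 < h"
  shows "1 - h \<le> F (ereal h)"
proof -
  obtain k where k: "0 < k" "{0..<inverse k} \<subseteq> levy_set k F H0" "k < h"
    using cInf_lessD[OF _ less[unfolded levy_dist_def]] one_in_levy_dist_set[OF F] by blast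
  \<comment> \<open>The point has to be positive, so that \<open>H0\<close> is 1 there, strictly
    below \<open>inverse k\<close>, since the interval is half-open, and at most
    \<open>h - k\<close>, so that \<open>t + k \<le> h\<close>.\<close>
  define t where "t = min (h - k) (inverse k / 2)"
  have t: "0 < t" "t < inverse k" "t + k \<le> h"
    using k by (auto simp: t_def min_def field_simps)
  then have "H0 (ereal t) \<le> F (ereal (t + k)) + k"
    using k(2) by (auto simp: levy_set_def subset_iff)
  moreover have "F (ereal (t + k)) \<le> F (ereal h)"
    using Delta_plus_mono[OF F] t by simp
  ultimately show ?thesis
    using t k by (simp add: H0_def)
qed

lemma levy_dist_H0_self: "levy_dist H0 H0 = 0"
proof (rule antisym)
  show "levy_dist H0 H0 \<le> 0"
    by (rule field_le_epsilon) (auto intro!: levy_dist_H0_le H0_in_Delta_plus simp: H0_def)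
qed (rule levy_dist_H0_nonneg[OF H0_in_Delta_plus])

lemma levy_dist_H0_eq_0D:
  assumes F: "F \<in> Delta_plus" and "levy_dist F H0 = 0"
  shows "F = H0"
proof
  fix t :: ereal
  show "F t = H0 t"
  proof (cases "t \<le> 0")
    case True
    then show ?thesis using Delta_plus_nonpos[OF F] by (simp add: H0_def)
  next
    case False
    have "1 \<le> F t + e" if "0 < e" for e
    proof -
      \<comment> \<open>\<open>t\<close> may be infinite, hence the real point \<open>u\<close>
        below it. Taking \<open>h = min e u\<close> keeps \<open>h\<close> below both the error
        \<open>e\<close> and the argument \<open>t\<close>.\<close>
      obtain u where u: "0 < ereal u" "ereal u < t"
        using ereal_dense2[of 0 t] False by (auto simp: not_le)
      define h where "h = min e u"
      have "1 - h \<le> F (ereal h)"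
        using levy_dist_H0_lessD[OF F] assms(2) that u by (simp add: h_def del: ereal_min)
      also have "\<dots> \<le> F t"
      proof (rule Delta_plus_mono[OF F])
        have "ereal h \<le> ereal u" by (simp add: h_def)
        with u(2) show "ereal h \<le> t" by (rule order.trans[OF _ less_imp_le, rotated])
      qed
      finally show ?thesis by (simp add: h_def)
    qed
    then have "1 \<le> F t" by (rule field_le_epsilon)
    then show ?thesis using Delta_plus_bounds[OF F, of t] False by (simp add: H0_def)
  qed
qed

text \<open>The criterion \<open>1 - h \<le> F (ereal h)\<close> is inherited by larger functions.
  This converts the probabilistic triangle inequality into an inequality between real
  distances.\<close>

lemma levy_dist_H0_antimono:
  assumes F: "F \<in> Delta_plus" and L: "L \<in> Delta_plus" and "df_le F L"
  shows "levy_dist L H0 \<le> levy_dist F H0"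
proof (rule dense_ge)
  fix h assume h: "levy_dist F H0 < h"
  have "1 - h \<le> F (ereal h)" by (rule levy_dist_H0_lessD[OF F h])
  also have "\<dots> \<le> L (ereal h)" using assms(3) by (simp add: df_le_def)
  finally show "levy_dist L H0 \<le> h"
    using levy_dist_H0_le[OF L] h levy_dist_H0_nonneg[OF F] by auto
qed

text \<open>The filter is arbitrary so that one equivalence covers both sequential limits and the
  double-index Cauchy condition.\<close>

lemma tendsto_H0_iff_levy_dist:
  assumes F: "\<And>i. F i \<in> Delta_plus"
  shows "(\<forall>t::real. ((\<lambda>i. F i (ereal t)) \<longlongrightarrow> H0 (ereal t)) A) \<longleftrightarrow>
    ((\<lambda>i. levy_dist (F i) H0) \<longlongrightarrow> 0) A"
proof (intro iffI allI)
  assume lim: "\<forall>t::real. ((\<lambda>i. F i (ereal t)) \<longlongrightarrow> H0 (ereal t)) A"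
  show "((\<lambda>i. levy_dist (F i) H0) \<longlongrightarrow> 0) A"
  proof (rule order_tendstoI)
    fix e :: real assume "0 < e"
    define h where "h = e / 2"
    have h: "0 < h" "h < e" using \<open>0 < e\<close> by (auto simp: h_def)
    have "\<forall>\<^sub>F i in A. 1 - h < F i (ereal h)"
      using h by (intro order_tendstoD(1)[OF lim[rule_format]]) (auto simp: H0_def)
    then show "\<forall>\<^sub>F i in A. levy_dist (F i) H0 < e"
    proof eventually_elim
      case (elim i)
      then show ?case using levy_dist_H0_le[OF F, of h i] h by simp
    qed
  qed (auto intro!: always_eventually intro: less_le_trans levy_dist_H0_nonneg[OF F])
next
  fix t :: real
  assume lim: "((\<lambda>i. levy_dist (F i) H0) \<longlongrightarrow> 0) A"
  show "((\<lambda>i. F i (ereal t)) \<longlongrightarrow> H0 (ereal t)) A"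
  proof (cases "t \<le> 0")
    case True
    then show ?thesis by (simp add: H0_def Delta_plus_nonpos[OF F])
  next
    case False
    show ?thesis
    proof (rule order_tendstoI)
      fix a assume a: "a < H0 (ereal t)"
      \<comment> \<open>\<open>h \<le> t\<close> lets monotonicity carry the bound from
        \<open>h\<close> to \<open>t\<close>, and \<open>h < 1 - a\<close> makes
        \<open>1 - h\<close> exceed \<open>a\<close>.\<close>
      define h where "h = min t ((1 - a) / 2)"
      have h: "0 < h" "h \<le> t" "h < 1 - a"
        using a False by (auto simp: h_def H0_def min_def split: if_splits)
      have "\<forall>\<^sub>F i in A. levy_dist (F i) H0 < h"
        using lim h(1) by (rule order_tendstoD)
      then show "\<forall>\<^sub>F i in A. a < F i (ereal t)"
      proof eventually_elim
        case (elim i)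
        have "F i (ereal h) \<le> F i (ereal t)"
          using Delta_plus_mono[OF F] h by simp
        then show ?case using levy_dist_H0_lessD[OF F elim] h by simp
      qed
    next
      fix a assume "H0 (ereal t) < a"
      then show "\<forall>\<^sub>F i in A. F i (ereal t) < a"
        using Delta_plus_bounds[OF F] False
        by (intro always_eventually) (auto simp: H0_def intro: le_less_trans)
    qed
  qed
qed

section \<open>Geometric decay and orbits of contractions in \<open>ennreal\<close>\<close>

lemma ennreal_power_mult_tendsto_0:
  assumes "0 \<le> q" "q < 1" "a < \<infinity>"
  shows "(\<lambda>n. ennreal q ^ n * a) \<longlonglongrightarrow> 0"
proof -
  have "(\<lambda>n. ennreal (q ^ n * enn2real a)) \<longlonglongrightarrow> ennreal (0 * enn2real a)"
    using assms by (intro tendsto_ennrealI tendsto_mult LIMSEQ_realpow_zero) auto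
  moreover have "ennreal (q ^ n * enn2real a) = ennreal q ^ n * a" for n
    using assms by (simp add: ennreal_mult ennreal_power)
  ultimately show ?thesis by simp
qed

lemma funpow_in: "f \<in> G \<rightarrow> G \<Longrightarrow> x \<in> G \<Longrightarrow> (f ^^ n) x \<in> G"
  by (induction n) auto

lemma contraction_funpow:
  fixes d :: "'a \<Rightarrow> 'a \<Rightarrow> ennreal"
  assumes f: "f \<in> G \<rightarrow> G" and xy: "x \<in> G" "y \<in> G"
    and contr: "\<And>x y. x \<in> G \<Longrightarrow> y \<in> G \<Longrightarrow> d (f x) (f y) \<le> c * d x y"
  shows "d ((f ^^ n) x) ((f ^^ n) y) \<le> c ^ n * d x y"
proof (induction n)
  case (Suc n)
  have "d ((f ^^ Suc n) x) ((f ^^ Suc n) y) \<le> c * d ((f ^^ n) x) ((f ^^ n) y)"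
    using contr funpow_in[OF f] xy by simp
  also have "\<dots> \<le> c * (c ^ n * d x y)"
    using Suc by (rule mult_left_mono) simp
  finally show ?case by (simp add: mult.assoc)
qed simp

text \<open>Stated for an abstract \<open>\<delta>\<close>, separated from distribution functions.
  The conclusion bounds \<open>\<omega> (\<delta> _ _)\<close> because that is the quantity which
  contracts; \<open>le\<close> then bounds \<open>\<delta>\<close> itself.\<close>

lemma modulus_contraction_orbit_Cauchy:
  fixes \<delta> :: "'a \<Rightarrow> 'a \<Rightarrow> ennreal"
  assumes \<omega>: "(\<omega> \<longlongrightarrow> 0) (nhds 0)"
    and triangle: "\<And>x y z. x \<in> G \<Longrightarrow> y \<in> G \<Longrightarrow> z \<in> G \<Longrightarrow> \<delta> x z \<le> \<omega> (\<delta> x y + \<delta> y z)"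
    and le: "\<And>x y. x \<in> G \<Longrightarrow> y \<in> G \<Longrightarrow> \<delta> x y \<le> \<omega> (\<delta> x y)"
    and fin: "\<And>x y. x \<in> G \<Longrightarrow> y \<in> G \<Longrightarrow> \<omega> (\<delta> x y) < \<infinity>"
    and q: "0 \<le> q" "q < 1"
    and contr: "\<And>x y. x \<in> G \<Longrightarrow> y \<in> G \<Longrightarrow> \<omega> (\<delta> (f x) (f y)) \<le> ennreal q * \<omega> (\<delta> x y)"
    and f: "f \<in> G \<rightarrow> G" and x: "x \<in> G" and "0 < e"
  shows "\<exists>n. \<forall>i j. n \<le> i \<longrightarrow> i \<le> j \<longrightarrow> \<omega> (\<delta> ((f ^^ i) x) ((f ^^ j) x)) < e"
proof -
  define z where "z n = (f ^^ n) x" for n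
  have zG: "z n \<in> G" for n
    unfolding z_def by (rule funpow_in[OF f x])
  have z_add: "z (n + k) = (f ^^ n) (z k)" for n k
    by (simp add: z_def funpow_add)
  have pow: "\<omega> (\<delta> ((f ^^ n) u) ((f ^^ n) v)) \<le> ennreal q ^ n * \<omega> (\<delta> u v)"
    if "u \<in> G" "v \<in> G" for n u v
    by (rule contraction_funpow[where d = "\<lambda>u v. \<omega> (\<delta> u v)", OF f that contr])
  \<comment> \<open>As \<open>\<omega>\<close> need not be monotone, smallness of its values is
    always obtained from a threshold on the argument near 0.\<close>
  have small: "\<exists>\<rho>>0. \<forall>s<\<rho>. \<omega> s < r" if "0 < r" for r
  proof -
    have "\<forall>\<^sub>F s in nhds 0. \<omega> s < r" using \<omega> that by (rule order_tendstoD)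
    then obtain S where S: "open S" "0 \<in> S" "\<And>s. s \<in> S \<Longrightarrow> \<omega> s < r"
      by (auto simp: eventually_nhds)
    obtain \<rho> where "0 < \<rho>" "{0..<\<rho>} \<subseteq> S"
      using open_right[OF S(1,2), of 1] by auto
    then show ?thesis using S(3) by (intro exI[of _ \<rho>]) auto
  qed
  \<comment> \<open>The cap at 1 keeps the radius finite even for infinite \<open>e\<close>, as the
    decay of \<open>ennreal q ^ N * r\<close> requires.\<close>
  define r where "r = min e 1"
  have r: "0 < r" "r \<le> e" "r < \<infinity>" using \<open>0 < e\<close> by (auto simp: r_def min_less_iff_disj)
  obtain \<rho> where \<rho>: "0 < \<rho>" "\<And>s. s < \<rho> \<Longrightarrow> \<omega> s < r" using small[OF r(1)] by auto
  \<comment> \<open>Two nested thresholds: the weak triangle inequality costs one application of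
    \<open>\<omega>\<close>, and the ball is itself defined through a second one.
    \<open>\<eta>'\<close> then splits \<open>\<eta>\<close> between the two legs of the
    triangle.\<close>
  obtain \<eta> where \<eta>: "0 < \<eta>" "\<And>s. s < \<eta> \<Longrightarrow> \<omega> s < \<rho>" using small[OF \<rho>(1)] by auto
  obtain \<eta>' where \<eta>': "0 < \<eta>'" "\<eta>' + \<eta>' \<le> \<eta>"
  proof
    show "0 < \<eta> / 2" using \<eta>(1) by (simp add: ennreal_zero_less_divide)
    have "\<eta> / 2 + \<eta> / 2 = (\<eta> * 2) / 2"
      by (simp only: mult_2_right add_divide_distrib_ennreal)
    then show "\<eta> / 2 + \<eta> / 2 \<le> \<eta>" by (simp add: ennreal_mult_divide_eq)
  qed
  have "\<forall>\<^sub>F N in sequentially. ennreal q ^ N * r < \<eta>'"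
    using ennreal_power_mult_tendsto_0[OF q r(3)] \<eta>'(1) by (rule order_tendstoD)
  then have "\<forall>\<^sub>F N in sequentially. 0 < N \<and> ennreal q ^ N * r < \<eta>'"
    by (rule eventually_conj[OF eventually_gt_at_top])
  from eventually_happens'[OF sequentially_bot this]
  obtain N where N: "0 < N" "ennreal q ^ N * r < \<eta>'" by blast
  have orbit_step: "\<forall>\<^sub>F n in sequentially. \<omega> (\<delta> (z n) (z (n + k))) < s" if "0 < s" for s k
  proof -
    have "\<forall>\<^sub>F n in sequentially. ennreal q ^ n * \<omega> (\<delta> (z 0) (z k)) < s"
      using ennreal_power_mult_tendsto_0[OF q fin[OF zG zG]] that by (rule order_tendstoD)
    then show ?thesis
    proof eventually_elim
      case (elim n)
      then show ?case
        using pow[OF zG zG, of n 0 k] by (simp flip: z_add)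
    qed
  qed
  \<comment> \<open>Only finitely many \<open>k\<close> occur, so one \<open>n\<close> serves them
    all. The bound \<open>r\<close> puts these iterates in the ball; the bound
    \<open>\<eta>'\<close>, at \<open>k = N\<close>, controls how far \<open>f ^^ N\<close> moves
    the centre.\<close>
  have "\<forall>\<^sub>F n in sequentially. \<forall>k\<in>{..N}. \<omega> (\<delta> (z n) (z (n + k))) < min r \<eta>'"
    using r(1) \<eta>'(1) by (intro eventually_ball_finite ballI orbit_step) simp_all
  from eventually_happens'[OF sequentially_bot this]
  obtain n where n: "\<And>k. k \<le> N \<Longrightarrow> \<omega> (\<delta> (z n) (z (n + k))) < min r \<eta>'" by blast
  \<comment> \<open>The intermediate point is \<open>z (n + N)\<close>, the image of the centre
    under \<open>f ^^ N\<close>: the choice of \<open>n\<close> bounds its distance from the centre,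
    the contraction its distance from the image of \<open>y\<close>.\<close>
  have step: "\<omega> (\<delta> (z n) ((f ^^ N) y)) < r" if y: "y \<in> G" "\<omega> (\<delta> (z n) y) < r" for y
  proof -
    have fy: "(f ^^ N) y \<in> G" by (rule funpow_in[OF f y(1)])
    have "\<delta> (z n) (z (n + N)) \<le> \<omega> (\<delta> (z n) (z (n + N)))" by (rule le[OF zG zG])
    also have "\<dots> < \<eta>'" using n[of N] by simp
    finally have 1: "\<delta> (z n) (z (n + N)) < \<eta>'" .
    have "\<delta> (z (n + N)) ((f ^^ N) y) \<le> \<omega> (\<delta> (z (n + N)) ((f ^^ N) y))"
      by (rule le[OF zG fy])
    also have "\<dots> \<le> ennreal q ^ N * \<omega> (\<delta> (z n) y)"
      using pow[OF zG y(1), of N n] z_add[of N n] by (simp add: add.commute[of n N])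
    also have "\<dots> \<le> ennreal q ^ N * r"
      using y(2) by (intro mult_left_mono) auto
    finally have 2: "\<delta> (z (n + N)) ((f ^^ N) y) < \<eta>'" using N(2) by simp
    have "\<delta> (z n) ((f ^^ N) y) \<le> \<omega> (\<delta> (z n) (z (n + N)) + \<delta> (z (n + N)) ((f ^^ N) y))"
      by (rule triangle[OF zG zG fy])
    also have "\<dots> < \<rho>"
      using add_strict_mono[OF 1 2] \<eta>'(2) by (intro \<eta>(2)) simp
    finally show ?thesis by (rule \<rho>(2))
  qed
  have ball: "\<omega> (\<delta> (z n) (z (n + k))) < r" for k
  proof (induction k rule: less_induct)
    case (less k)
    show ?case
    proof (cases "k \<le> N")
      case True
      then show ?thesis using n[of k] by simp
    next
      case False
      \<comment> \<open>The descent from \<open>k\<close> to \<open>k - N\<close> is strict because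
        \<open>0 < N\<close>; applying \<open>f ^^ N\<close> to that earlier orbit point gives
        \<open>z (n + k)\<close>.\<close>
      then have "\<omega> (\<delta> (z n) (z (n + (k - N)))) < r" using N(1) by (intro less) auto
      then show ?thesis
        using step[OF zG, of "n + (k - N)"] False by (simp flip: z_add)
    qed
  qed
  have "\<omega> (\<delta> (z i) (z j)) < e" if "n \<le> i" "i \<le> j" for i j
  proof -
    \<comment> \<open>The pair \<open>(i, j)\<close> is the pair \<open>(n, n + (j - i))\<close>
      shifted by \<open>i - n\<close>, and iterating \<open>f\<close> does not increase
      \<open>\<omega> (\<delta> _ _)\<close>.\<close>
    have "\<omega> (\<delta> (z i) (z j)) \<le> ennreal q ^ (i - n) * \<omega> (\<delta> (z n) (z (n + (j - i))))"
      using pow[OF zG zG, of "i - n" n "n + (j - i)"] that by (simp flip: z_add)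
    also have "\<dots> \<le> 1 * \<omega> (\<delta> (z n) (z (n + (j - i))))"
      using q by (intro mult_right_mono power_le_one) auto
    also have "\<dots> < e" using ball[of "j - i"] r(2) by simp
    finally show ?thesis .
  qed
  then show ?thesis unfolding z_def by blast
qed

section \<open>Existence and uniqueness of the fixed point\<close>

theorem theorem2:
  fixes G :: "'a set"
    and D :: "'a \<Rightarrow> 'a \<Rightarrow> ereal \<Rightarrow> real"
    and star :: df_op
    and \<omega> :: "ennreal \<Rightarrow> ennreal"
    and f :: "'a \<Rightarrow> 'a"
    and q :: real
  assumes "G \<noteq> {}"
    and "prob_metric_space G D star"
    and "pm_complete G D"
    and "continuous_triangle_function star"
    and "modulus_unif_cont star \<omega>"
    and "\<And>x y. x \<in> G \<Longrightarrow> y \<in> G \<Longrightarrow> \<omega> (ennreal (levy_dist (D x y) H0)) < \<infinity>"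
    and "f \<in> G \<rightarrow> G"
    and "0 < q" and "q < 1"
    and "modulus_contraction G D \<omega> q f"
  shows "\<exists>!x. x \<in> G \<and> f x = x"
proof -
  define \<delta> where "\<delta> x y = ennreal (levy_dist (D x y) H0)" for x y
  note pm = assms(2)[unfolded prob_metric_space_def]
  have Delta: "D x y \<in> Delta_plus" if "x \<in> G" "y \<in> G" for x y
    using pm that by blast
  have sym: "\<delta> x y = \<delta> y x" if "x \<in> G" "y \<in> G" for x y
    using pm that by (simp add: \<delta>_def)
  have tri: "triangle_function star" using pm by blast
  have H0_neutral: "star F H0 = F" if "F \<in> Delta_plus" for F
    using tri that by (simp add: triangle_function_def)
  have modulus: "ennreal (levy_dist (star F L) H0)
      \<le> \<omega> (ennreal (levy_dist F H0) + ennreal (levy_dist L H0))"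
    if F: "F \<in> Delta_plus" and L: "L \<in> Delta_plus" for F L
  proof -
    have "ennreal (levy_dist (star F L) (star H0 H0))
        \<le> \<omega> (ennreal (levy_dist F H0 + levy_dist L H0))"
      using assms(5) F L H0_in_Delta_plus unfolding modulus_unif_cont_def by blast
    then show ?thesis
      by (simp add: H0_neutral H0_in_Delta_plus levy_dist_H0_nonneg F L)
  qed
  have le: "\<delta> x y \<le> \<omega> (\<delta> x y)" if "x \<in> G" "y \<in> G" for x y
    using modulus[OF Delta H0_in_Delta_plus, of x y] that
    by (simp add: H0_neutral Delta levy_dist_H0_self \<delta>_def)
  have triangle: "\<delta> x z \<le> \<omega> (\<delta> x y + \<delta> y z)" if G: "x \<in> G" "y \<in> G" "z \<in> G" for x y z
  proof -
    have "star (D x y) (D y z) \<in> Delta_plus"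
      using tri Delta G unfolding triangle_function_def by blast
    moreover have "df_le (star (D x y) (D y z)) (D x z)" using pm G by blast
    ultimately have "\<delta> x z \<le> ennreal (levy_dist (star (D x y) (D y z)) H0)"
      unfolding \<delta>_def using Delta G by (intro ennreal_leI levy_dist_H0_antimono) auto
    also have "\<dots> \<le> \<omega> (\<delta> x y + \<delta> y z)"
      unfolding \<delta>_def by (rule modulus[OF Delta Delta]) (use G in auto)
    finally show ?thesis .
  qed
  have eqI: "x = y" if "x \<in> G" "y \<in> G" "\<delta> x y = 0" for x y
  proof -
    have "levy_dist (D x y) H0 = 0"
      using that levy_dist_H0_nonneg[OF Delta, of x y] by (simp add: \<delta>_def ennreal_eq_0_iff)
    then have "D x y = H0" using Delta that by (intro levy_dist_H0_eq_0D)
    then show ?thesis using pm that by blast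
  qed
  \<comment> \<open>The value \<open>\<omega> 0 = 0\<close> upgrades the punctured limit to
    \<open>nhds 0\<close>, so that it composes with sequences that may attain 0.\<close>
  have \<omega>: "(\<omega> \<longlongrightarrow> 0) (nhds 0)"
    using assms(5) tendsto_at_iff_tendsto_nhds[of \<omega> 0] by (auto simp: modulus_unif_cont_def)
  have fin: "\<omega> (\<delta> x y) < \<infinity>" if "x \<in> G" "y \<in> G" for x y
    unfolding \<delta>_def using assms(6) that .
  have contr: "\<omega> (\<delta> (f x) (f y)) \<le> ennreal q * \<omega> (\<delta> x y)" if "x \<in> G" "y \<in> G" for x y
    using assms(10) that by (simp add: modulus_contraction_def \<delta>_def)
  \<comment> \<open>The index type stays free: it is a type of pairs for the Cauchy property and
    \<open>nat\<close> for convergence to the limit.\<close>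
  have lim_iff: "(\<forall>t::real. ((\<lambda>i. D (u i) (v i) (ereal t)) \<longlongrightarrow> H0 (ereal t)) A) \<longleftrightarrow>
      ((\<lambda>i. \<delta> (u i) (v i)) \<longlongrightarrow> 0) A"
    if "\<And>i. u i \<in> G" "\<And>i. v i \<in> G" for u v :: "'i \<Rightarrow> 'a" and A
  proof -
    have *: "D (u i) (v i) \<in> Delta_plus" for i using Delta that by blast
    have "((\<lambda>i. \<delta> (u i) (v i)) \<longlongrightarrow> ennreal 0) A \<longleftrightarrow> ((\<lambda>i. levy_dist (D (u i) (v i)) H0) \<longlongrightarrow> 0) A"
      unfolding \<delta>_def by (rule tendsto_ennreal_iff) (simp_all add: levy_dist_H0_nonneg[OF *])
    then show ?thesis by (simp add: tendsto_H0_iff_levy_dist[OF *])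
  qed

  obtain x where x: "x \<in> G" using assms(1) by auto
  define z where "z n = (f ^^ n) x" for n
  have zG: "z n \<in> G" for n unfolding z_def by (rule funpow_in[OF assms(7) x])
  have Cauchy: "\<exists>n. \<forall>i j. n \<le> i \<longrightarrow> i \<le> j \<longrightarrow> \<omega> (\<delta> (z i) (z j)) < e" if "0 < e" for e
    unfolding z_def
  proof (rule modulus_contraction_orbit_Cauchy[where \<delta> = \<delta> and G = G and q = q, OF \<omega>])
    show "0 \<le> q" "q < 1" "f \<in> G \<rightarrow> G" "x \<in> G" "0 < e"
      using assms x that by simp_all
  qed (fact triangle le fin contr)+
  have "((\<lambda>p. \<delta> (z (fst p)) (z (snd p))) \<longlongrightarrow> 0) (sequentially \<times>\<^sub>F sequentially)"
  proof (rule order_tendstoI)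
    fix e :: ennreal assume "0 < e"
    then obtain n where n: "\<And>i j. n \<le> i \<Longrightarrow> i \<le> j \<Longrightarrow> \<omega> (\<delta> (z i) (z j)) < e"
      using Cauchy by blast
    have "\<delta> (z i) (z j) < e" if "n \<le> i" "n \<le> j" for i j
    proof (cases "i \<le> j")
      case True
      then show ?thesis using le[OF zG zG] n that by (blast intro: le_less_trans)
    next
      case False
      then show ?thesis using le[OF zG zG, of j i] n[of j i] that sym[OF zG zG, of i j] by simp
    qed
    then show "\<forall>\<^sub>F p in sequentially \<times>\<^sub>F sequentially. \<delta> (z (fst p)) (z (snd p)) < e"
      unfolding eventually_prod_sequentially by auto
  qed simp
  then have "pm_Cauchy D z"
    unfolding pm_Cauchy_def case_prod_beta by (subst lim_iff) (auto intro: zG)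
  then obtain w where w: "w \<in> G" "\<forall>t::real. (\<lambda>n. D (z n) w (ereal t)) \<longlonglongrightarrow> H0 (ereal t)"
    using assms(3) zG unfolding pm_complete_def by blast
  have fw: "f w \<in> G" using assms(7) w by auto
  have lim: "(\<lambda>n. \<delta> (z n) w) \<longlonglongrightarrow> 0"
    using w(2) by (subst (asm) lim_iff) (auto intro: zG w(1))
  have upper: "(\<lambda>n. ennreal q * \<omega> (\<delta> (z n) w)) \<longlonglongrightarrow> ennreal q * 0"
    by (intro ennreal_tendsto_cmult filterlim_compose[OF \<omega> lim]) simp
  \<comment> \<open>The contraction supplies continuity of \<open>f\<close> along the orbit, so the
    shifted orbit tends to \<open>f w\<close> as well as to \<open>w\<close>. The weak triangle
    inequality then forces the two limits to coincide.\<close>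
  have "\<delta> (z (Suc n)) (f w) \<le> ennreal q * \<omega> (\<delta> (z n) w)" for n
    using le[OF zG fw, of "Suc n"] contr[OF zG w(1), of n] by (simp add: z_def)
  then have "(\<lambda>n. \<delta> (z (Suc n)) (f w)) \<longlonglongrightarrow> 0"
    by (intro tendsto_sandwich[OF _ _ tendsto_const upper[unfolded mult_zero_right]] always_eventually)
      simp_all
  moreover have "(\<lambda>n. \<delta> w (z (Suc n))) \<longlonglongrightarrow> 0"
    using LIMSEQ_Suc[OF lim] by (simp add: sym[OF w(1) zG])
  ultimately have "(\<lambda>n. \<delta> w (z (Suc n)) + \<delta> (z (Suc n)) (f w)) \<longlonglongrightarrow> 0 + 0"
    by (intro tendsto_add)
  then have "(\<lambda>n. \<omega> (\<delta> w (z (Suc n)) + \<delta> (z (Suc n)) (f w))) \<longlonglongrightarrow> 0"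
    by (intro filterlim_compose[OF \<omega>]) simp
  then have "\<delta> w (f w) \<le> 0"
    by (rule LIMSEQ_le_const) (use triangle[OF w(1) zG fw] in blast)
  then have fix_w: "f w = w"
    using eqI[OF w(1) fw] by simp
  moreover have "y = w" if y: "y \<in> G" "f y = y" for y
  proof (rule eqI[OF y(1) w(1)])
    \<comment> \<open>Two fixed points are unmoved by all iterates, so their distance lies below
      every term of this sequence; its limit is 0 because \<open>\<omega> (\<delta> y w)\<close> is
      finite.\<close>
    have "(\<lambda>n. ennreal q ^ n * \<omega> (\<delta> y w)) \<longlonglongrightarrow> 0"
      using assms(8,9) fin[OF y(1) w(1)] by (intro ennreal_power_mult_tendsto_0) auto
    moreover have "\<delta> y w \<le> ennreal q ^ n * \<omega> (\<delta> y w)" for n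
    proof -
      have "(f ^^ n) y = y" "(f ^^ n) w = w"
        using y(2) fix_w by (induction n) auto
      then show ?thesis
        using le[OF y(1) w(1)]
          contraction_funpow[where d = "\<lambda>u v. \<omega> (\<delta> u v)", OF assms(7) y(1) w(1) contr, of n]
        by simp
    qed
    ultimately have "\<delta> y w \<le> 0" by (intro LIMSEQ_le_const) auto
    then show "\<delta> y w = 0" by simp
  qed
  ultimately show ?thesis using w(1) by blast
qed

end
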